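(* Let $G$ be the path on three vertices (with any edge directions), let $\mathfrak n_G$ be the associated metric 2-step nilpotent Lie algebra, and let $N$ be the simply connected 2-step nilpotent Lie group with Lie algebra $\mathfrak n_G$, with the left invariant Riemannian metric determined by the inner product. Then for any lattice $\Gamma$ in $N$, $\Gamma\backslash N$ has the density of closed geodesics property.
   Context: Construction of $\mathfrak{n}_G$: let $G=(S,E)$ be a finite simple directed graph with at least one edge, with vertex set $S=\{X_1,\dots,X_m\}$ and edge set $E=\{Z_1,\dots,Z_q\}$. Let $\mathcal V$ be the real vector space with basis $S$, $\mathfrak z$ the real vector space with basis $E$, and $\mathfrak n_G=\mathcal V\oplus\mathfrak z$. The Lie bracket is the bilinear skew-symmetric extension of: $[X_i,X_l]=Z_k$ if $Z_k$ is a directed edge from $X_i$ to $X_l$; $[X_i,X_l]=0$ if $X_i,X_l$ are not adjacent; and $[\mathfrak n_G,\mathfrak z]=0$. The inner product is the one making $S\cup E$ orthonormal. A lattice $\Gamma\subseteq N$ is a discrete cocompact subgroup; $\Gamma\backslash N$ carries the Riemannian metric induced by the left invariant metric on $N$. A compact Riemannian manifold $M$ has the density of closed geodesics property if the (unit) vectors tangent to smoothly closed geodesics are dense in the unit tangent bundle of $M$. *)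

theory Defs
  imports "HOL-Analysis.Analysis" "HOL-Algebra.Coset" "Graph_Theory.Digraph"
begin

section \<open>The metric Lie algebra of a directed graph\<close>

text \<open>
  The path u - v - w. Only the unordered ends of the two arcs are prescribed, so all four
  choices of directions are covered.
\<close>

definition path3 :: "('v, 'e) pre_digraph \<Rightarrow> bool" where
  "path3 G \<longleftrightarrow>
     (\<exists>u v w. distinct [u, v, w] \<and> verts G = {u, v, w} \<and>
       (\<exists>e f. e \<noteq> f \<and> arcs G = {e, f} \<and>
          {tail G e, head G e} = {u, v} \<and> {tail G f, head G f} = {v, w}))"

text \<open>
  For a graph with \<open>verts G = UNIV\<close> and \<open>arcs G = UNIV\<close> the Lie algebra is the space
  \<open>real ^ ('v + 'e)\<close>: the basis vector of a vertex \<open>a\<close> is \<open>axis (Inl a) 1\<close>, that of an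
  edge \<open>e\<close> is \<open>axis (Inr e) 1\<close>, and the standard inner product makes these vectors orthonormal.
\<close>

definition bracket ::
  "('v::finite, 'e::finite) pre_digraph \<Rightarrow> real ^ ('v + 'e) \<Rightarrow> real ^ ('v + 'e) \<Rightarrow> real ^ ('v + 'e)"
where
  "bracket G x y =
     (\<Sum>e\<in>arcs G. (x $ Inl (tail G e) * y $ Inl (head G e) - x $ Inl (head G e) * y $ Inl (tail G e))
        *\<^sub>R axis (Inr e) 1)"

text \<open>
  For a simple graph (no loops, at most one edge between two vertices) this is the bilinear
  skew-symmetric extension of \<open>[X_i, X_l] = Z_k\<close> for an edge
  \<open>Z_k\<close> from \<open>X_i\<close> to \<open>X_l\<close>, \<open>[X_i, X_l] = 0\<close> for non-adjacent vertices, and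
  \<open>[n, z] = 0\<close>.
\<close>

lemma bilinear_bracket: "bilinear (bracket G)"
  unfolding bilinear_def
  by (intro conjI allI linearI)
    (simp_all add: bracket_def algebra_simps sum.distrib scaleR_sum_right sum_subtractf)

lemma bracket_skew: "bracket G y x = - bracket G x y"
  by (simp add: bracket_def algebra_simps flip: sum_negf)

lemma bracket_Inl [simp]: "bracket G x y $ Inl a = 0"
  by (simp add: bracket_def axis_def)

lemma bracket_edge:
  assumes "e \<in> arcs G" "tail G e \<noteq> head G e"
    and "\<And>f. f \<in> arcs G \<Longrightarrow> {tail G f, head G f} = {tail G e, head G e} \<Longrightarrow> f = e"
  shows "bracket G (axis (Inl (tail G e)) 1) (axis (Inl (head G e)) 1) = axis (Inr e) 1"
proof -
  have "bracket G (axis (Inl (tail G e)) 1) (axis (Inl (head G e)) 1)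
      = (\<Sum>f\<in>arcs G. if f = e then axis (Inr e) 1 else 0)"
    unfolding bracket_def
  proof (rule sum.cong[OF refl])
    fix f assume f: "f \<in> arcs G"
    show "(axis (Inl (tail G e)) 1 $ Inl (tail G f) * axis (Inl (head G e)) 1 $ Inl (head G f) -
        axis (Inl (tail G e)) 1 $ Inl (head G f) * axis (Inl (head G e)) 1 $ Inl (tail G f))
        *\<^sub>R axis (Inr f) 1 = (if f = e then axis (Inr e) (1::real) else 0)"
      using assms(2) assms(3)[OF f] by (auto simp: axis_def insert_commute)
  qed
  also have "\<dots> = axis (Inr e) 1"
    using assms(1) by simp
  finally show ?thesis .
qed

lemma bracket_nonadjacent:
  assumes "\<And>e. e \<in> arcs G \<Longrightarrow> {tail G e, head G e} \<noteq> {a, b}"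
  shows "bracket G (axis (Inl a) 1) (axis (Inl b) 1) = 0"
  unfolding bracket_def by (intro sum.neutral) (use assms in \<open>fastforce simp: axis_def\<close>)

lemma bracket_central [simp]:
  "bracket G x (axis (Inr e) r) = 0" "bracket G (axis (Inr e) r) x = 0"
  by (simp_all add: bracket_def axis_def)

lemma bracket_bracket [simp]: "bracket G x (bracket G y z) = 0" "bracket G (bracket G y z) x = 0"
  by (simp_all add: bracket_def[of _ _ "bracket _ _ _"] bracket_def[of _ "bracket _ _ _"])


section \<open>The simply connected Lie group\<close>

text \<open>
  The exponential map of a simply connected nilpotent Lie group is a diffeomorphism, and in
  exponential coordinates the multiplication of a 2-step group is the Baker-Campbell-Hausdorff
  formula \<open>x * y = x + y + [x, y] / 2\<close>. The tangent space at the identity \<open>0\<close> is the Lie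
  algebra itself.
\<close>

definition nil_group :: "('v::finite, 'e::finite) pre_digraph \<Rightarrow> (real ^ ('v + 'e)) monoid" where
  "nil_group G =
     \<lparr>carrier = UNIV, mult = (\<lambda>x y. x + y + (1 / 2) *\<^sub>R bracket G x y), one = 0\<rparr>"

lemma nil_group_simps [simp]:
  "carrier (nil_group G) = UNIV"
  "mult (nil_group G) x y = x + y + (1 / 2) *\<^sub>R bracket G x y"
  "one (nil_group G) = 0"
  by (simp_all add: nil_group_def)

lemma bracket_self [simp]: "bracket G x x = 0"
  by (simp add: bracket_def)

lemmas bracket_bilin =
  bilinear_ladd[OF bilinear_bracket] bilinear_radd[OF bilinear_bracket]
  bilinear_lmul[OF bilinear_bracket] bilinear_rmul[OF bilinear_bracket]
  bilinear_lneg[OF bilinear_bracket] bilinear_rneg[OF bilinear_bracket]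
  bilinear_lsub[OF bilinear_bracket] bilinear_rsub[OF bilinear_bracket]
  bilinear_lzero[OF bilinear_bracket] bilinear_rzero[OF bilinear_bracket]

lemma group_nil_group: "group (nil_group G)"
proof (rule groupI)
  fix x assume "x \<in> carrier (nil_group G)"
  show "\<exists>y\<in>carrier (nil_group G). mult (nil_group G) y x = one (nil_group G)"
    by (rule bexI[of _ "- x"]) (simp_all add: bracket_bilin)
qed (simp_all add: bracket_bilin algebra_simps)

lemma inv_nil_group [simp]: "inv\<^bsub>nil_group G\<^esub> x = - x"
  by (rule group.inv_equality[OF group_nil_group]) (simp_all add: bracket_bilin)


section \<open>Left invariant metrics and geodesics\<close>

definition left_diff ::
  "('a::euclidean_space) monoid \<Rightarrow> 'a \<Rightarrow> 'a \<Rightarrow> 'a \<Rightarrow> 'a" where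
  "left_diff N a x = frechet_derivative (\<lambda>y. a \<otimes>\<^bsub>N\<^esub> y) (at x)"

text \<open>
  The inner product of the Lie algebra, transported from the identity to \<open>x\<close> by left translation.
\<close>

definition left_inv_metric :: "('a::euclidean_space) monoid \<Rightarrow> 'a \<Rightarrow> 'a \<Rightarrow> 'a \<Rightarrow> real" where
  "left_inv_metric N x u v =
     left_diff N (inv\<^bsub>N\<^esub> x) x u \<bullet> left_diff N (inv\<^bsub>N\<^esub> x) x v"

lemma left_diff_nil_group: "left_diff (nil_group G) a x v = v + (1 / 2) *\<^sub>R bracket G a v"
proof -
  have lin: "linear (bracket G a)"
    using bilinear_bracket[of G] by (simp add: bilinear_def)
  have "((\<lambda>y. a + y + (1 / 2) *\<^sub>R bracket G a y) has_derivative
      (\<lambda>v. v + (1 / 2) *\<^sub>R bracket G a v)) (at x)"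
    by (auto intro!: derivative_eq_intros linear_imp_has_derivative lin)
  from frechet_derivative_at[OF this, symmetric] show ?thesis
    by (simp only: left_diff_def nil_group_simps)
qed

lemma left_inv_metric_one: "left_inv_metric (nil_group G) 0 u v = u \<bullet> v"
  by (simp add: left_inv_metric_def left_diff_nil_group bracket_bilin)

lemma left_inv_metric_invariant:
  "left_inv_metric (nil_group G) (a \<otimes>\<^bsub>nil_group G\<^esub> x)
     (left_diff (nil_group G) a x u) (left_diff (nil_group G) a x v) = left_inv_metric (nil_group G) x u v"
  by (simp add: left_inv_metric_def left_diff_nil_group bracket_bilin algebra_simps)

text \<open>
  The Lie algebra of \<open>nil_group G\<close>, i.e. its left invariant vector fields with the Lie bracket of
  vector fields \<open>[U, V](p) = DV_p(U p) - DU_p(V p)\<close>, is the Lie algebra of \<open>G\<close>.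
\<close>

lemma lie_algebra_nil_group:
  fixes G :: "('v::finite, 'e::finite) pre_digraph" and u v p :: "real ^ ('v + 'e)"
  defines "L \<equiv> \<lambda>w x. left_diff (nil_group G) x 0 w"
  shows "frechet_derivative (L v) (at p) (L u p) - frechet_derivative (L u) (at p) (L v p)
    = L (bracket G u v) p"
proof -
  have D: "frechet_derivative (L w) (at p) h = (1 / 2) *\<^sub>R bracket G h w" for w h
  proof -
    have lin: "linear (\<lambda>x. bracket G x w)"
      using bilinear_bracket[of G] by (simp add: bilinear_def)
    have "((\<lambda>x. w + (1 / 2) *\<^sub>R bracket G x w) has_derivative
        (\<lambda>h. (1 / 2) *\<^sub>R bracket G h w)) (at p)"
      by (auto intro!: derivative_eq_intros linear_imp_has_derivative lin)
    from frechet_derivative_at[OF this, symmetric] show ?thesis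
      by (simp only: L_def left_diff_nil_group)
  qed
  show ?thesis
    unfolding D by (simp add: L_def left_diff_nil_group bracket_bilin bracket_skew[of G v u]
        flip: scaleR_left_distrib)
qed

text \<open>
  The Levi-Civita connection on constant vector fields, given by the Koszul formula:
  \<open>christoffel g x u v\<close> is the vector with components \<open>\<Gamma>^k_ij u^i v^j\<close>. It is
  determined by the formula because \<open>g x\<close> is an inner product.
\<close>

definition christoffel ::
  "('a::euclidean_space \<Rightarrow> 'a \<Rightarrow> 'a \<Rightarrow> real) \<Rightarrow> 'a \<Rightarrow> 'a \<Rightarrow> 'a \<Rightarrow> 'a" where
  "christoffel g x u v =
     (THE z. \<forall>w. g x z w =
        (frechet_derivative (\<lambda>y. g y v w) (at x) u
         + frechet_derivative (\<lambda>y. g y u w) (at x) v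
         - frechet_derivative (\<lambda>y. g y u v) (at x) w) / 2)"

lemma left_inv_metric_pos:
  assumes "v \<noteq> 0"
  shows "left_inv_metric (nil_group G) x v v > 0"
proof -
  have "v + (1 / 2) *\<^sub>R bracket G (- x) v \<noteq> 0"
  proof
    assume eq: "v + (1 / 2) *\<^sub>R bracket G (- x) v = 0"
    then have "bracket G x (v + (1 / 2) *\<^sub>R bracket G (- x) v) = 0"
      by (simp add: bracket_bilin)
    then have "bracket G x v = 0"
      by (simp add: bracket_bilin)
    with eq assms show False
      by (simp add: bracket_bilin)
  qed
  then show ?thesis
    by (simp add: left_inv_metric_def left_diff_nil_group)
qed

lemma frechet_derivative_left_inv_metric:
  "frechet_derivative (\<lambda>y. left_inv_metric (nil_group G) y u v) (at x) h =
     - ((1 / 2) *\<^sub>R bracket G h u \<bullet> (v - (1 / 2) *\<^sub>R bracket G x v)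
        + (u - (1 / 2) *\<^sub>R bracket G x u) \<bullet> (1 / 2) *\<^sub>R bracket G h v)"
proof -
  have lin: "linear (\<lambda>x. bracket G x w)" for w
    using bilinear_bracket[of G] by (simp add: bilinear_def)
  have "((\<lambda>y. (u - (1 / 2) *\<^sub>R bracket G y u) \<bullet> (v - (1 / 2) *\<^sub>R bracket G y v)) has_derivative
      (\<lambda>h. (u - (1 / 2) *\<^sub>R bracket G x u) \<bullet> (0 - (1 / 2) *\<^sub>R bracket G h v)
        + (0 - (1 / 2) *\<^sub>R bracket G h u) \<bullet> (v - (1 / 2) *\<^sub>R bracket G x v))) (at x)"
    by (intro has_derivative_inner has_derivative_diff has_derivative_const has_derivative_scaleR_right
        linear_imp_has_derivative lin)
  note D = frechet_derivative_at[OF this, symmetric]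
  have "(\<lambda>y. left_inv_metric (nil_group G) y u v)
      = (\<lambda>y. (u - (1 / 2) *\<^sub>R bracket G y u) \<bullet> (v - (1 / 2) *\<^sub>R bracket G y v))"
    by (simp add: left_inv_metric_def left_diff_nil_group bracket_bilin)
  then show ?thesis
    by (simp only: D) (simp add: algebra_simps)
qed

lemma christoffel_nil_group_koszul:
  fixes G :: "('v::finite, 'e::finite) pre_digraph"
  defines "g \<equiv> left_inv_metric (nil_group G)"
  shows "g x (christoffel g x u v) w =
        (frechet_derivative (\<lambda>y. g y v w) (at x) u
         + frechet_derivative (\<lambda>y. g y u w) (at x) v
         - frechet_derivative (\<lambda>y. g y u v) (at x) w) / 2" (is "_ = ?F w")
proof -
  have F: "linear ?F"
    unfolding g_def frechet_derivative_left_inv_metric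
    by (rule linearI) (simp_all add: bracket_bilin algebra_simps inner_simps field_simps)
  define A where "A w = w - (1 / 2) *\<^sub>R bracket G x w" for w
  define B where "B w = w + (1 / 2) *\<^sub>R bracket G x w" for w
  have AB: "A (B w) = w" "B (A w) = w" for w
    by (simp_all add: A_def B_def bracket_bilin)
  have g: "g x z w = A z \<bullet> A w" for z w
    by (simp add: g_def A_def left_inv_metric_def left_diff_nil_group bracket_bilin)
  have "linear B"
    by (rule linearI) (simp_all add: B_def bracket_bilin algebra_simps)
  then have lin: "linear (\<lambda>w. ?F (B w))"
    using linear_compose[OF _ F] by (simp add: o_def)
  define r where "r = adjoint (\<lambda>w. ?F (B w)) 1"
  have r: "?F (B w) = r \<bullet> w" for w
    using adjoint_works[OF lin, of w 1] unfolding r_def inner_real_def mult_1_right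
    by (simp only: inner_commute)
  have *: "\<forall>w. g x (B r) w = ?F w"
  proof
    fix w
    have "?F w = ?F (B (A w))"
      by (simp only: AB(2))
    also have "\<dots> = r \<bullet> A w"
      by (rule r)
    finally show "g x (B r) w = ?F w"
      by (simp only: g AB(1))
  qed
  have "z = B r" if "\<forall>w. g x z w = ?F w" for z
  proof -
    have "(A z - r) \<bullet> A w = 0" for w
    proof -
      have "g x z w = g x (B r) w"
        using that * by metis
      then show ?thesis
        by (simp add: g AB(1) inner_diff_left)
    qed
    from this[of "B (A z - r)"] have "A z = r"
      by (simp add: AB(1))
    then have "B r = B (A z)"
      by simp
    then show ?thesis
      by (simp only: AB(2))
  qed
  with * have "\<forall>w. g x (christoffel g x u v) w = ?F w"
    unfolding christoffel_def by (rule theI[where P = "\<lambda>z. \<forall>w. g x z w = ?F w"])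
  then show ?thesis ..
qed

abbreviation velocity :: "(real \<Rightarrow> 'a::euclidean_space) \<Rightarrow> real \<Rightarrow> 'a" where
  "velocity c t \<equiv> vector_derivative c (at t)"

definition geodesic_eq_at ::
  "('a::euclidean_space \<Rightarrow> 'a \<Rightarrow> 'a \<Rightarrow> real) \<Rightarrow> (real \<Rightarrow> 'a) \<Rightarrow> real \<Rightarrow> bool" where
  "geodesic_eq_at g c t \<longleftrightarrow>
     c differentiable (at t) \<and>
     (velocity c has_vector_derivative - christoffel g (c t) (velocity c t) (velocity c t)) (at t)"


section \<open>Quotients by lattices\<close>

definition quotient_topology :: "'a topology \<Rightarrow> ('a \<Rightarrow> 'b) \<Rightarrow> 'b topology" where
  "quotient_topology X f =
     topology (\<lambda>U. U \<subseteq> f ` topspace X \<and> openin X {x \<in> topspace X. f x \<in> U})"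

lemma openin_quotient_topology:
  "openin (quotient_topology X f) U \<longleftrightarrow>
     U \<subseteq> f ` topspace X \<and> openin X {x \<in> topspace X. f x \<in> U}"
proof -
  have "istopology (\<lambda>U. U \<subseteq> f ` topspace X \<and> openin X {x \<in> topspace X. f x \<in> U})"
    unfolding istopology_def
  proof (intro conjI allI impI)
    fix S T
    assume "S \<subseteq> f ` topspace X \<and> openin X {x \<in> topspace X. f x \<in> S}"
      and "T \<subseteq> f ` topspace X \<and> openin X {x \<in> topspace X. f x \<in> T}"
    moreover have "{x \<in> topspace X. f x \<in> S \<inter> T}
        = {x \<in> topspace X. f x \<in> S} \<inter> {x \<in> topspace X. f x \<in> T}"
      by auto
    ultimately show "S \<inter> T \<subseteq> f ` topspace X" "openin X {x \<in> topspace X. f x \<in> S \<inter> T}"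
      by auto
  next
    fix \<K>
    assume K: "\<forall>K\<in>\<K>. K \<subseteq> f ` topspace X \<and> openin X {x \<in> topspace X. f x \<in> K}"
    have "{x \<in> topspace X. f x \<in> \<Union>\<K>} = (\<Union>K\<in>\<K>. {x \<in> topspace X. f x \<in> K})"
      by auto
    then show "\<Union>\<K> \<subseteq> f ` topspace X" "openin X {x \<in> topspace X. f x \<in> \<Union>\<K>}"
      using K by auto
  qed
  then show ?thesis
    by (simp add: quotient_topology_def)
qed

lemma topspace_quotient_topology [simp]: "topspace (quotient_topology X f) = f ` topspace X"
proof -
  have "{x \<in> topspace X. f x \<in> f ` topspace X} = topspace X"
    by auto
  then have "openin (quotient_topology X f) (f ` topspace X)"
    by (simp add: openin_quotient_topology)
  then show ?thesis
    by (meson openin_quotient_topology openin_subset openin_topspace subset_antisym)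
qed

lemma quotient_map_quotient_topology: "quotient_map X (quotient_topology X f) f"
  by (auto simp: quotient_map_def openin_quotient_topology)

text \<open>
  The points of \<open>\<Gamma>\N\<close> are the right cosets \<open>\<Gamma> #>\<^bsub>N\<^esub> x\<close>, the orbits of the
  action of \<open>\<Gamma>\<close> by left translations.
\<close>

definition lie_lattice :: "('a::euclidean_space) monoid \<Rightarrow> 'a set \<Rightarrow> bool" where
  "lie_lattice N \<Gamma> \<longleftrightarrow>
     subgroup \<Gamma> N \<and> discrete \<Gamma> \<and>
     compact_space (quotient_topology (top_of_set (carrier N)) (\<lambda>x. \<Gamma> #>\<^bsub>N\<^esub> x))"

text \<open>
  The tangent bundle of \<open>\<Gamma>\N\<close> is \<open>\<Gamma>\TN\<close>: the tangent vector represented by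
  \<open>(x, v)\<close> is identified with its orbit under the differentials of the left translations.
  These are isometries, so the metric of \<open>N\<close> descends to \<open>\<Gamma>\TN\<close>.
\<close>

definition tangent_orbit ::
  "('a::euclidean_space) monoid \<Rightarrow> 'a set \<Rightarrow> 'a \<times> 'a \<Rightarrow> ('a \<times> 'a) set" where
  "tangent_orbit N \<Gamma> = (\<lambda>(x, v). (\<lambda>\<gamma>. (\<gamma> \<otimes>\<^bsub>N\<^esub> x, left_diff N \<gamma> x v)) ` \<Gamma>)"

definition unit_tangent_bundle :: "('a::euclidean_space) monoid \<Rightarrow> ('a \<times> 'a) set" where
  "unit_tangent_bundle N = {(x, v). x \<in> carrier N \<and> left_inv_metric N x v v = 1}"

definition quot_unit_tangent_bundle ::
  "('a::euclidean_space) monoid \<Rightarrow> 'a set \<Rightarrow> ('a \<times> 'a) set topology" where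
  "quot_unit_tangent_bundle N \<Gamma> =
     quotient_topology (top_of_set (unit_tangent_bundle N)) (tangent_orbit N \<Gamma>)"

text \<open>
  The metric of \<open>\<Gamma>\N\<close> is the one for which the projection from \<open>N\<close> is a local isometry, so
  the geodesics of \<open>\<Gamma>\N\<close> are the curves that near each time are projections of geodesics
  of \<open>N\<close>.
\<close>

definition geodesic_lift_at ::
  "('a::euclidean_space) monoid \<Rightarrow> 'a set \<Rightarrow> (real \<Rightarrow> 'a set) \<Rightarrow> real \<Rightarrow> (real \<Rightarrow> 'a) \<Rightarrow> bool" where
  "geodesic_lift_at N \<Gamma> \<sigma> t c \<longleftrightarrow>
     (\<forall>\<^sub>F s in nhds t. c s \<in> carrier N \<and> \<sigma> s = \<Gamma> #>\<^bsub>N\<^esub> c s \<and>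
        geodesic_eq_at (left_inv_metric N) c s)"

definition quot_geodesic ::
  "('a::euclidean_space) monoid \<Rightarrow> 'a set \<Rightarrow> (real \<Rightarrow> 'a set) \<Rightarrow> bool" where
  "quot_geodesic N \<Gamma> \<sigma> \<longleftrightarrow> (\<forall>t. \<exists>c. geodesic_lift_at N \<Gamma> \<sigma> t c)"

text \<open>
  A periodic geodesic on the whole real line is smoothly closed. Constant geodesics are not excluded
  here, but they have no unit tangent vectors.
\<close>

definition closed_geodesic ::
  "('a::euclidean_space) monoid \<Rightarrow> 'a set \<Rightarrow> (real \<Rightarrow> 'a set) \<Rightarrow> bool" where
  "closed_geodesic N \<Gamma> \<sigma> \<longleftrightarrow>
     quot_geodesic N \<Gamma> \<sigma> \<and> (\<exists>\<omega>>0. \<forall>t. \<sigma> (t + \<omega>) = \<sigma> t)"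

definition closed_geodesic_unit_vectors ::
  "('a::euclidean_space) monoid \<Rightarrow> 'a set \<Rightarrow> ('a \<times> 'a) set set" where
  "closed_geodesic_unit_vectors N \<Gamma> =
     {tangent_orbit N \<Gamma> (c t, velocity c t) | \<sigma> t c.
        closed_geodesic N \<Gamma> \<sigma> \<and> geodesic_lift_at N \<Gamma> \<sigma> t c \<and>
        (c t, velocity c t) \<in> unit_tangent_bundle N}"

definition density_of_closed_geodesics ::
  "('a::euclidean_space) monoid \<Rightarrow> 'a set \<Rightarrow> bool" where
  "density_of_closed_geodesics N \<Gamma> \<longleftrightarrow>
     quot_unit_tangent_bundle N \<Gamma> closure_of closed_geodesic_unit_vectors N \<Gamma>
       = topspace (quot_unit_tangent_bundle N \<Gamma>)"

end

theory Submission
  imports Defs "HOL-Real_Asymp.Real_Asymp"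
begin

text \<open>
  A geodesic of a left invariant metric is governed by its velocity \<open>Q\<close>, translated back to the
  Lie algebra. Here the central component of \<open>Q\<close> is constant, say \<open>r z\<close> with \<open>|z| = 1\<close>, and
  the component orthogonal to the centre evolves by \<open>X' = r j(z) X\<close>, where \<open>j(z)\<close> is the skew map
  with \<open>j(z) x \<bullet> y = z \<bullet> [x, y]\<close>. Because the path has three vertices, this is an infinitesimal
  rotation about an axis. So if \<open>r \<noteq> 0\<close> then \<open>Q\<close>
  is periodic, and after any number \<open>k\<close> of periods the geodesic has been
  moved by a left translation by an element \<open>g\<close> of the group. The geodesic closes in the
  quotient as soon as \<open>g\<close> is in the lattice (\<open>helix_translation\<close>,
  \<open>unit_helix_velocity_closed\<close>).

  The element \<open>g\<close> lies in the four-dimensional abelian ideal \<open>M\<close> spanned by the two ends of the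
  path and the two edges, and it is \<open>k\<close> times an element \<open>g\<^sub>1\<close> of \<open>M\<close>
  that depends on the geodesic. Two things make this work.

  First, every lattice is compatible with \<open>M\<close>: its intersection with \<open>M\<close> spans \<open>M\<close>, so
  that the elements \<open>\<gamma> / k\<close> with \<open>\<gamma>\<close> in this intersection are dense in \<open>M\<close>
  (\<open>all_approximable\<close>). The reason is that the lattice gives a rational structure, for which the kernel
  of the bracket on the second exterior power of the complement of the centre is a rational line; it
  belongs to the plane spanned by the two ends of the path, which is therefore rational.

  Second, the geodesic can be recovered continuously from \<open>g\<^sub>1\<close> when the remaining data,
  namely the phase and the other coordinates of the starting point, are kept fixed
  (\<open>unit_helix_velocity_closure\<close>). A small change of the geodesic thus moves \<open>g\<^sub>1\<close>
  to any prescribed nearby element, in particular to some \<open>\<gamma> / k\<close>.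

  This recovery works for all unit vectors outside a proper algebraic subset, and these are dense.
\<close>

section \<open>Geodesics of 2-step nilpotent groups\<close>

text \<open>
  Writing the velocity as the left translate of a curve \<open>Q\<close> in the Lie algebra turns the geodesic
  equation into an ordinary differential equation for \<open>Q\<close> alone, the Euler-Arnold equation
  \<open>Q' = ad(Q)\<^sup>* Q\<close>. In exponential coordinates the left translate of \<open>Q\<close> to \<open>c\<close>
  is \<open>Q + [c, Q] / 2\<close>.
\<close>

lemma nil_group_geodesicI:
  fixes c Q R :: "real \<Rightarrow> real ^ ('v::finite + 'e::finite)"
  assumes c: "\<And>t. (c has_vector_derivative Q t + (1 / 2) *\<^sub>R bracket G (c t) (Q t)) (at t)"
    and Q: "\<And>t. (Q has_vector_derivative R t) (at t)"
    and euler: "\<And>t w. R t \<bullet> w = Q t \<bullet> bracket G (Q t) w"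
  shows "geodesic_eq_at (left_inv_metric (nil_group G)) c t"
proof -
  let ?g = "left_inv_metric (nil_group G)"
  define q where "q t = Q t + (1 / 2) *\<^sub>R bracket G (c t) (Q t)" for t
  define a where "a t = R t + (1 / 2) *\<^sub>R bracket G (c t) (R t)" for t
  interpret b: bounded_bilinear "bracket G"
    using bilinear_bracket bilinear_conv_bounded_bilinear by blast
  have vel: "velocity c = q"
    using c vector_derivative_at unfolding q_def by blast
  have dQ: "(q has_vector_derivative a t) (at t)"
  proof -
    have "((\<lambda>t. bracket G (c t) (Q t)) has_vector_derivative
        bracket G (c t) (R t) + bracket G (q t) (Q t)) (at t)"
      unfolding q_def by (rule b.has_vector_derivative[OF c Q])
    moreover have "bracket G (q t) (Q t) = 0"
      by (simp add: q_def bracket_bilin)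
    ultimately have "((\<lambda>t. Q t + (1 / 2) *\<^sub>R bracket G (c t) (Q t)) has_vector_derivative
        R t + (1 / 2) *\<^sub>R bracket G (c t) (R t)) (at t)"
      by (auto intro!: derivative_eq_intros Q)
    then show ?thesis
      by (simp add: q_def[abs_def] a_def)
  qed
  have g: "?g (c t) u w = (u - (1 / 2) *\<^sub>R bracket G (c t) u) \<bullet> (w - (1 / 2) *\<^sub>R bracket G (c t) w)" for u w
    by (simp add: left_inv_metric_def left_diff_nil_group bracket_bilin)
  have trivQ: "q t - (1 / 2) *\<^sub>R bracket G (c t) (q t) = Q t"
    by (simp add: q_def bracket_bilin)
  have triva: "a t - (1 / 2) *\<^sub>R bracket G (c t) (a t) = R t"
    by (simp add: a_def bracket_bilin)
  let ?C = "christoffel ?g (c t) (q t) (q t)"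
  have C: "?g (c t) ?C w = - (Q t \<bullet> bracket G (q t) w)" for w
    unfolding christoffel_nil_group_koszul frechet_derivative_left_inv_metric trivQ
    by (simp add: inner_commute bracket_skew[of G w])
  have qw: "bracket G (q t) w = bracket G (Q t) (w - (1 / 2) *\<^sub>R bracket G (c t) w)" for w
    by (simp add: q_def bracket_bilin)
  have "?g (c t) (?C + a t) w = 0" for w
  proof -
    have "?g (c t) (?C + a t) w = ?g (c t) ?C w + ?g (c t) (a t) w"
      unfolding g by (simp add: bracket_bilin inner_simps algebra_simps)
    also have "?g (c t) (a t) w = Q t \<bullet> bracket G (q t) w"
      unfolding g triva euler qw ..
    finally show ?thesis
      by (simp add: C)
  qed
  then have "?C + a t = 0"
    using left_inv_metric_pos[of "?C + a t" G "c t"] by force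
  then have "a t = - ?C"
    by (simp add: eq_neg_iff_add_eq_0 add.commute)
  then show ?thesis
    using dQ differentiableI_vector[OF c] by (simp add: geodesic_eq_at_def vel fun_cong[OF vel])
qed

section \<open>The Lie algebra of the path in coordinates\<close>

text \<open>
  The Lie algebra of the path is \<open>\<real> \<oplus> \<complex> \<oplus> \<complex>\<close> with bracket
  \<open>[(a, b, c), (a', b', c')] = (0, 0, a b' - a' b)\<close>: \<open>a\<close> is the coefficient of the middle
  vertex, \<open>b\<close> collects the coefficients of the two ends, and \<open>c\<close> those of the two edges, with
  signs that absorb the directions of the edges. Complex numbers are used for the two planes because
  all rotations below then become multiplications.
\<close>

locale path_frame =
  fixes G :: "('v::finite, 'e::finite) pre_digraph"
    and E :: "real \<times> complex \<times> complex \<Rightarrow> real ^ ('v + 'e)"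
  assumes linear_E: "linear E"
    and inner_E: "E x \<bullet> E y = x \<bullet> y"
    and surj_E: "surj E"
    and bracket_E: "bracket G (E (a, b, c)) (E (a', b', c')) = E (0, 0, a *\<^sub>R b' - a' *\<^sub>R b)"

lemma path3_frame:
  fixes G :: "('v::finite, 'e::finite) pre_digraph"
  assumes "verts G = UNIV" "arcs G = UNIV" "path3 G"
  shows "\<exists>E. path_frame G E"
proof -
  obtain u v w e f where dist: "distinct [u, v, w]" and V: "UNIV = {u, v, w}"
    and ef: "e \<noteq> f" and A: "UNIV = {e, f}"
    and e: "{tail G e, head G e} = {u, v}" and f: "{tail G f, head G f} = {v, w}"
    using assms unfolding path3_def by auto
  define se :: real where "se = (if tail G e = v then 1 else -1)"
  define sf :: real where "sf = (if tail G f = v then 1 else -1)"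
  have s: "se = 1 \<or> se = -1" "sf = 1 \<or> sf = -1"
    by (auto simp: se_def sf_def)
  define E :: "real \<times> complex \<times> complex \<Rightarrow> real ^ ('v + 'e)" where
    "E = (\<lambda>(a, b, c). a *\<^sub>R axis (Inl v) 1 + Re b *\<^sub>R axis (Inl u) 1 + Im b *\<^sub>R axis (Inl w) 1
      + (se * Re c) *\<^sub>R axis (Inr e) 1 + (sf * Im c) *\<^sub>R axis (Inr f) 1)"
  have nth: "E (a, b, c) $ Inl v = a" "E (a, b, c) $ Inl u = Re b" "E (a, b, c) $ Inl w = Im b"
     "E (a, b, c) $ Inr e = se * Re c" "E (a, b, c) $ Inr f = sf * Im c" for a b c
    using dist ef by (auto simp: E_def axis_def)
  have univ: "(UNIV :: ('v + 'e) set) = {Inl v, Inl u, Inl w, Inr e, Inr f}"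
    by (simp add: UNIV_sum V A) auto
  have all: "(\<forall>i. P i) \<longleftrightarrow> P (Inl v) \<and> P (Inl u) \<and> P (Inl w) \<and> P (Inr e) \<and> P (Inr f)"
    for P :: "'v + 'e \<Rightarrow> bool"
    using univ by (metis UNIV_I empty_iff insert_iff)
  have arcs: "arcs G = {e, f}"
    using assms(2) A by simp
  have sum_UNIV: "sum h UNIV = h (Inl v) + h (Inl u) + h (Inl w) + h (Inr e) + h (Inr f)"
    for h :: "'v + 'e \<Rightarrow> real"
    unfolding univ using dist ef by auto
  have "path_frame G E"
  proof (rule path_frame.intro)
    show "linear E"
      by (rule linearI) (auto simp: E_def algebra_simps split: prod.splits)
    show "E x \<bullet> E y = x \<bullet> y" for x y
      using s by (cases x; cases y) (auto simp: inner_vec_def sum_UNIV nth inner_complex_def)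
    show "surj E"
    proof
      show "UNIV \<subseteq> range E"
      proof
        fix x
        have "x = E (x $ Inl v, Complex (x $ Inl u) (x $ Inl w),
            Complex (se * x $ Inr e) (sf * x $ Inr f))"
          using s by (auto simp: vec_eq_iff all nth)
        then show "x \<in> range E"
          by blast
      qed
    qed simp
    have e': "tail G e = v \<and> head G e = u \<and> se = 1 \<or> tail G e = u \<and> head G e = v \<and> se = -1"
      using e dist by (auto simp: se_def doubleton_eq_iff)
    have f': "tail G f = v \<and> head G f = w \<and> sf = 1 \<or> tail G f = w \<and> head G f = v \<and> sf = -1"
      using f dist by (auto simp: sf_def doubleton_eq_iff)
    show "bracket G (E (a, b, c)) (E (a', b', c')) = E (0, 0, a *\<^sub>R b' - a' *\<^sub>R b)" for a b c a' b' c'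
      using e' f' ef dist unfolding vec_eq_iff all
      by (elim disjE conjE) (simp_all add: bracket_def arcs nth axis_def)
  qed
  then show ?thesis
    by (rule exI[where x=E])
qed

lemma (in path_frame) E_arith:
  "E x + E y = E (x + y)" "E x - E y = E (x - y)" "- E x = E (- x)" "r *\<^sub>R E x = E (r *\<^sub>R x)"
  "E 0 = 0"
  using linear_E by (simp_all add: linear_add linear_diff linear_neg linear_scale linear_0)

lemma (in path_frame) E_cases:
  obtains a b c where "x = E (a, b, c)"
  using surj_E by (metis prod.exhaust surj_def)

lemma (in path_frame) E_eq_iff: "E x = E y \<longleftrightarrow> x = y"
proof
  assume "E x = E y"
  then have "E (x - y) = 0"
    by (simp flip: E_arith)
  then show "x = y"
    using inner_E[of "x - y" "x - y"] by simp
qed simp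

section \<open>Helices\<close>

text \<open>
  The integral curve through the point \<open>(0, - \<rho> z, - \<i> \<rho> S z)\<close> of left translates of
  \<open>hodograph\<close> (defined next), which for \<open>|z| = 1\<close> solves the Euler-Arnold equation up to the
  choice of speed. Here \<open>z\<close> is the direction of the central component. The part of the velocity
  in the plane of \<open>(1, 0, 0)\<close> and \<open>(0, z, 0)\<close> runs through a circle of radius \<open>\<rho>\<close>, and
  the part \<open>(0, \<i> S z, 0)\<close> along the axis of the rotation stays fixed. The time is the angle
  \<open>\<tau>\<close> on the circle.
\<close>

definition helix :: "real \<Rightarrow> real \<Rightarrow> complex \<Rightarrow> real \<Rightarrow> real \<times> complex \<times> complex" where
  "helix \<rho> S z \<tau> =
     (\<rho> * sin \<tau>, Complex (- \<rho> * cos \<tau>) (S * \<tau>) * z,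
      Complex (\<tau> * (1 + \<rho>\<^sup>2 / 2)) (- \<rho> * S / 2 * (\<tau> * sin \<tau> + 2 * cos \<tau>)) * z)"

definition hodograph :: "real \<Rightarrow> real \<Rightarrow> complex \<Rightarrow> real \<Rightarrow> real \<times> complex \<times> complex" where
  "hodograph \<rho> S z \<tau> = (\<rho> * cos \<tau>, Complex (\<rho> * sin \<tau>) S * z, z)"

lemma has_vector_derivative_Complex:
  assumes "(f has_real_derivative f') (at x)" "(g has_real_derivative g') (at x)"
  shows "((\<lambda>x. Complex (f x) (g x)) has_vector_derivative Complex f' g') (at x)"
  using assms by (simp add: has_vector_derivative_complex_iff)

lemma hodograph_deriv:
  "(hodograph \<rho> S z has_vector_derivative (- \<rho> * sin t, Complex (\<rho> * cos t) 0 * z, 0)) (at t)"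
  unfolding hodograph_def[abs_def]
  by (intro has_vector_derivative_Pair has_vector_derivative_mult_left has_vector_derivative_Complex
      has_vector_derivative_const)
    (auto intro!: derivative_eq_intros simp flip: has_real_derivative_iff_has_vector_derivative)

lemma (in path_frame) helix_deriv:
  "((\<lambda>t. E (helix \<rho> S z t)) has_vector_derivative
     E (hodograph \<rho> S z t) + (1 / 2) *\<^sub>R bracket G (E (helix \<rho> S z t)) (E (hodograph \<rho> S z t))) (at t)"
proof -
  have "(helix \<rho> S z has_vector_derivative
      (\<rho> * cos t, Complex (\<rho> * sin t) S * z,
       Complex (1 + \<rho>\<^sup>2 / 2) (- \<rho> * S / 2 * (t * cos t - sin t)) * z)) (at t)"
    unfolding helix_def[abs_def]
    by (intro has_vector_derivative_Pair has_vector_derivative_mult_left has_vector_derivative_Complex)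
      (auto intro!: derivative_eq_intros simp: field_simps
        simp flip: has_real_derivative_iff_has_vector_derivative)
  note D = bounded_linear.has_vector_derivative[OF linear_conv_bounded_linear[THEN iffD1, OF linear_E] this]
  have "Complex (1 + \<rho>\<^sup>2 / 2) (- \<rho> * S / 2 * (t * cos t - sin t)) =
      1 + (1 / 2) *\<^sub>R ((\<rho> * sin t) *\<^sub>R Complex (\<rho> * sin t) S
        - (\<rho> * cos t) *\<^sub>R Complex (- \<rho> * cos t) (S * t))"
  proof -
    have "\<rho>\<^sup>2 = \<rho> * sin t * (\<rho> * sin t) + \<rho> * cos t * (\<rho> * cos t)"
      using sin_cos_squared_add[of t] by algebra
    then show ?thesis
      by (simp add: complex_eq_iff field_simps)
  qed
  then have "Complex (1 + \<rho>\<^sup>2 / 2) (- \<rho> * S / 2 * (t * cos t - sin t)) * z =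
      z + (1 / 2) *\<^sub>R ((\<rho> * sin t) *\<^sub>R (Complex (\<rho> * sin t) S * z)
        - (\<rho> * cos t) *\<^sub>R (Complex (- \<rho> * cos t) (S * t) * z))"
    by (simp only: ring_distribs mult_1_left mult_scaleR_left)
  with D show ?thesis
    by (simp add: helix_def hodograph_def bracket_E E_arith)
qed

text \<open>
  The Euler-Arnold equation is quadratic, so it survives the change of time from \<open>t\<close> to \<open>r t\<close>;
  left translations by \<open>p\<close> are isometries and leave \<open>Q\<close> unchanged.
\<close>

lemma (in path_frame) geodesic_translated_helix:
  fixes p :: "real ^ ('v + 'e)" and \<rho> S r :: real
  assumes "cmod z = 1"
  defines "c \<equiv> \<lambda>t. p \<otimes>\<^bsub>nil_group G\<^esub> E (helix \<rho> S z (r * t))"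
    and "Q \<equiv> \<lambda>t. r *\<^sub>R E (hodograph \<rho> S z (r * t))"
  shows "geodesic_eq_at (left_inv_metric (nil_group G)) c t"
    and "velocity c t = Q t + (1 / 2) *\<^sub>R bracket G (c t) (Q t)"
proof -
  interpret b: bounded_bilinear "bracket G"
    using bilinear_bracket bilinear_conv_bounded_bilinear by blast
  interpret E: bounded_linear E
    using linear_E linear_conv_bounded_linear by blast
  have rt: "((\<lambda>t. r * t) has_vector_derivative r) (at t)" for t
    by (auto intro!: derivative_eq_intros simp flip: has_real_derivative_iff_has_vector_derivative)
  have dc: "(c has_vector_derivative Q t + (1 / 2) *\<^sub>R bracket G (c t) (Q t)) (at t)" for t
  proof -
    let ?q = "Q t + (1 / 2) *\<^sub>R bracket G (E (helix \<rho> S z (r * t))) (Q t)"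
    have h: "((\<lambda>t. E (helix \<rho> S z (r * t))) has_vector_derivative ?q) (at t)"
      using vector_diff_chain_at[OF rt helix_deriv]
      by (simp add: o_def Q_def bracket_bilin scaleR_add_right)
    have "(c has_vector_derivative ?q + (1 / 2) *\<^sub>R bracket G p ?q) (at t)"
      unfolding c_def nil_group_simps
      by (auto intro!: derivative_eq_intros h
          b.bounded_linear_right[THEN bounded_linear.has_vector_derivative])
    moreover have "?q + (1 / 2) *\<^sub>R bracket G p ?q = Q t + (1 / 2) *\<^sub>R bracket G (c t) (Q t)"
      by (simp add: c_def bracket_bilin algebra_simps)
    ultimately show ?thesis
      by simp
  qed
  then show "velocity c t = Q t + (1 / 2) *\<^sub>R bracket G (c t) (Q t)"
    by (rule vector_derivative_at)
  define R where "R t = r\<^sup>2 *\<^sub>R E (- \<rho> * sin (r * t), Complex (\<rho> * cos (r * t)) 0 * z, 0)" for t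
  have dQ: "(Q has_vector_derivative R t) (at t)" for t
    using has_vector_derivative_scaleR[OF DERIV_const[of r] E.has_vector_derivative[OF
      vector_diff_chain_at[OF rt hodograph_deriv]]]
    by (simp add: o_def Q_def R_def[abs_def] power2_eq_square E_arith mult.assoc)
  have zz: "z \<bullet> z = 1"
    using assms(1) by (simp add: dot_square_norm)
  have "R t \<bullet> w = Q t \<bullet> bracket G (Q t) w" for t w
  proof (cases w rule: E_cases)
    case (1 a b d)
    have "z \<bullet> (Complex m n * z) = m" for m n
      using zz by (simp add: inner_complex_def algebra_simps) algebra
    then show ?thesis
      by (simp add: 1 Q_def R_def hodograph_def bracket_E inner_E bracket_bilin power2_eq_square
          inner_diff_right algebra_simps)
         (simp add: inner_complex_def algebra_simps)
  qed
  with dc dQ show "geodesic_eq_at (left_inv_metric (nil_group G)) c t"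
    by (rule nil_group_geodesicI)
qed

lemma mem_unit_tangent_bundle_iff:
  "(x, v) \<in> unit_tangent_bundle (nil_group G) \<longleftrightarrow> norm (v - (1 / 2) *\<^sub>R bracket G x v) = 1"
  by (simp add: unit_tangent_bundle_def left_inv_metric_def left_diff_nil_group bracket_bilin norm_eq_1)

context path_frame
begin

text \<open>
  The speed \<open>1 / sqrt (1 + S\<^sup>2 + \<rho>\<^sup>2)\<close> is the one at which the helix has unit velocity
  if \<open>|z| = 1\<close>. It does not depend on \<open>\<tau>\<close>.
\<close>

definition unit_helix_velocity ::
  "real ^ ('v + 'e) \<Rightarrow> real \<Rightarrow> real \<Rightarrow> complex \<Rightarrow> real \<Rightarrow> (real ^ ('v + 'e)) \<times> (real ^ ('v + 'e))" where
  "unit_helix_velocity p \<rho> S z \<tau> =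
     (let x = p \<otimes>\<^bsub>nil_group G\<^esub> E (helix \<rho> S z \<tau>);
          Q = (1 / sqrt (1 + S\<^sup>2 + \<rho>\<^sup>2)) *\<^sub>R E (hodograph \<rho> S z \<tau>)
      in (x, Q + (1 / 2) *\<^sub>R bracket G x Q))"

lemma norm_hodograph:
  assumes "cmod z = 1"
  shows "norm (E (hodograph \<rho> S z \<tau>)) = sqrt (1 + S\<^sup>2 + \<rho>\<^sup>2)"
proof -
  have z: "(Re z)\<^sup>2 + (Im z)\<^sup>2 = 1"
    using assms by (simp add: cmod_def)
  have "(\<rho> * cos \<tau>)\<^sup>2 + ((\<rho> * sin \<tau>)\<^sup>2 + S\<^sup>2) * ((Re z)\<^sup>2 + (Im z)\<^sup>2) + ((Re z)\<^sup>2 + (Im z)\<^sup>2) = 1 + S\<^sup>2 + \<rho>\<^sup>2"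
    unfolding z using sin_cos_squared_add[of \<tau>] by algebra
  then show ?thesis
    by (simp add: norm_eq_sqrt_inner inner_E hodograph_def inner_complex_def algebra_simps power2_eq_square)
qed

text \<open>
  After \<open>k\<close> full rotations the velocity has returned, so the translated helix has moved by a left
  translation. The translating element is the displacement of the helix conjugated by \<open>p\<close>;
  conjugation only adds the term with \<open>\<alpha>\<close>. It lies in the abelian ideal
  where the first coordinate vanishes, and it depends on \<open>p\<close> only through \<open>\<alpha>\<close>.
\<close>

lemma helix_translation:
  fixes k :: nat
  defines "\<omega> \<equiv> 2 * pi * real k"
  shows "E (\<alpha>, \<beta>, \<zeta>) \<otimes>\<^bsub>nil_group G\<^esub> E (helix \<rho> S z (\<tau> + \<omega>)) =
    E (0, \<omega> *\<^sub>R (Complex 0 S * z, Complex (1 + \<rho>\<^sup>2 / 2) (\<alpha> * S) * z))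
      \<otimes>\<^bsub>nil_group G\<^esub> (E (\<alpha>, \<beta>, \<zeta>) \<otimes>\<^bsub>nil_group G\<^esub> E (helix \<rho> S z \<tau>))"
proof -
  have "sin (\<tau> + \<omega>) = sin \<tau>" "cos (\<tau> + \<omega>) = cos \<tau>"
    using sin_2npi[of k] cos_2npi[of k] by (simp_all add: \<omega>_def sin_add cos_add mult.commute mult.left_commute)
  then show ?thesis
    by (simp add: helix_def bracket_E E_arith E_eq_iff complex_eq_iff field_simps)
qed

lemma unit_helix_velocity_tendsto:
  assumes "(\<alpha> \<longlongrightarrow> \<alpha>') F" "(\<rho> \<longlongrightarrow> \<rho>') F" "(S \<longlongrightarrow> S') F" "(z \<longlongrightarrow> z') F"
  shows "((\<lambda>k. unit_helix_velocity (E (\<alpha> k, \<beta>, \<zeta>)) (\<rho> k) (S k) (z k) \<tau>)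
    \<longlongrightarrow> unit_helix_velocity (E (\<alpha>', \<beta>, \<zeta>)) \<rho>' S' z' \<tau>) F"
proof -
  interpret b: bounded_bilinear "bracket G"
    using bilinear_bracket bilinear_conv_bounded_bilinear by blast
  interpret E: bounded_linear E
    using linear_E linear_conv_bounded_linear by blast
  have "1 + S'\<^sup>2 + \<rho>'\<^sup>2 > 0"
    by (simp add: add_pos_nonneg)
  then have "sqrt (1 + S'\<^sup>2 + \<rho>'\<^sup>2) \<noteq> 0"
    by simp
  then show ?thesis
    unfolding unit_helix_velocity_def Let_def nil_group_simps helix_def hodograph_def
    by (intro tendsto_intros b.tendsto E.tendsto tendsto_Complex assms) simp_all
qed

text \<open>
  The parameters of the helix can be read off from its unit velocity: the speed is
  \<open>r = |c|\<close>, the direction is \<open>z = c / r\<close>, and the others follow from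
  \<open>b / c = \<rho> sin \<tau> + \<i> S\<close> and \<open>a / r = \<rho> cos \<tau>\<close>. The translation \<open>p\<close> is then
  determined by the base point.
\<close>

lemma generic_unit_helix_velocity:
  assumes Q: "norm (E (a, b, c)) = 1" and a: "a \<noteq> 0" and bc: "Im (b * cnj c) \<noteq> 0"
  shows "\<exists>p \<rho> S z \<tau>. \<rho> > 0 \<and> S \<noteq> 0 \<and> cmod z = 1 \<and>
    (x, E (a, b, c) + (1 / 2) *\<^sub>R bracket G x (E (a, b, c))) = unit_helix_velocity p \<rho> S z \<tau>"
proof -
  have c: "c \<noteq> 0"
    using bc by auto
  define w where "w = Complex (a / cmod c) (Re (b / c))"
  define \<rho> where "\<rho> = cmod w"
  define \<tau> where "\<tau> = Arg w"
  define S where "S = Im (b / c)"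
  define z where "z = c / cmod c"
  define p where "p = x + - E (helix \<rho> S z \<tau>) + (1 / 2) *\<^sub>R bracket G x (- E (helix \<rho> S z \<tau>))"
  have z: "cmod z = 1"
    using c by (simp add: z_def norm_divide)
  have "Re w \<noteq> 0"
    using a c by (simp add: w_def)
  then have "w \<noteq> 0"
    by auto
  then have "\<rho> > 0"
    by (simp add: \<rho>_def)
  have S: "S \<noteq> 0"
    using bc unfolding S_def Im_complex_div_eq_0 .
  have w: "\<rho> * cos \<tau> = a / cmod c" "\<rho> * sin \<tau> = Re (b / c)"
    using arg_cong[OF rcis_cmod_Arg[of w], of Re] arg_cong[OF rcis_cmod_Arg[of w], of Im]
    unfolding \<rho>_def \<tau>_def by (simp_all only: Re_rcis Im_rcis) (simp_all add: w_def)
  have QE: "E (a, b, c) = cmod c *\<^sub>R E (hodograph \<rho> S z \<tau>)"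
  proof -
    have "b = c * Complex (\<rho> * sin \<tau>) S"
      unfolding w S_def using c by simp
    then have "b = cmod c *\<^sub>R (Complex (\<rho> * sin \<tau>) S * z)"
      using c by (simp add: z_def scaleR_conv_of_real)
    moreover have "c = cmod c *\<^sub>R z"
      using c by (simp add: z_def scaleR_conv_of_real)
    moreover have "a = cmod c *\<^sub>R (\<rho> * cos \<tau>)"
      unfolding w using c by simp
    ultimately have "(a, b, c) = cmod c *\<^sub>R hodograph \<rho> S z \<tau>"
      unfolding hodograph_def scaleR_Pair by (intro arg_cong2[of _ _ _ _ Pair])
    then show ?thesis
      by (simp only: E_arith)
  qed
  have "cmod c * sqrt (1 + S\<^sup>2 + \<rho>\<^sup>2) = 1"
    using Q unfolding QE by (simp add: norm_hodograph[OF z])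
  then have "1 / sqrt (1 + S\<^sup>2 + \<rho>\<^sup>2) = cmod c"
    by (metis mult.commute nonzero_divide_eq_eq mult_zero_right zero_neq_one)
  moreover have "p \<otimes>\<^bsub>nil_group G\<^esub> E (helix \<rho> S z \<tau>) = x"
    by (simp add: p_def bracket_bilin)
  ultimately have "(x, E (a, b, c) + (1 / 2) *\<^sub>R bracket G x (E (a, b, c))) = unit_helix_velocity p \<rho> S z \<tau>"
    by (simp add: unit_helix_velocity_def Let_def QE del: nil_group_simps(2))
  with \<open>\<rho> > 0\<close> S z show ?thesis
    by blast
qed

end

section \<open>Discrete subgroups and approximation\<close>

lemma int_multiple_mem:
  fixes D :: "'a::real_vector set"
  assumes "\<And>x y. x \<in> D \<Longrightarrow> y \<in> D \<Longrightarrow> x - y \<in> D" "x \<in> D"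
  shows "of_int k *\<^sub>R x \<in> D"
proof -
  have 0: "0 \<in> D"
    using assms(1)[OF assms(2) assms(2)] by simp
  have neg: "- y \<in> D" if "y \<in> D" for y
    using assms(1)[OF 0 that] by simp
  have nat: "real n *\<^sub>R x \<in> D" for n
  proof (induction n)
    case (Suc n)
    then show ?case
      using assms(1)[OF Suc neg[OF assms(2)]] by (simp add: algebra_simps)
  qed (simp add: 0)
  show ?thesis
    using nat neg[OF nat] by (cases k rule: int_cases2) auto
qed

text \<open>
  A pigeonhole argument: modulo the lattice spanned by \<open>y\<close> and \<open>z\<close>, the multiples of
  \<open>l y + m z\<close> stay in a bounded set, which contains only finitely many points of \<open>D\<close>. So two
  of them agree, and comparing the coefficients of \<open>y\<close> makes a multiple of \<open>l\<close> an integer.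
\<close>

lemma uniform_discrete_coeff_rational:
  fixes D :: "'a::{real_normed_vector, heine_borel} set"
  assumes disc: "uniform_discrete D" and diff: "\<And>x y. x \<in> D \<Longrightarrow> y \<in> D \<Longrightarrow> x - y \<in> D"
    and y: "y \<in> D" and z: "z \<in> D"
    and indep: "\<And>a b. a *\<^sub>R y + b *\<^sub>R z = 0 \<Longrightarrow> a = 0"
    and D: "l *\<^sub>R y + m *\<^sub>R z \<in> D"
  shows "\<exists>n::nat. 0 < n \<and> real n * l \<in> \<int>"
proof -
  define f where "f n = frac (real n * l) *\<^sub>R y + frac (real n * m) *\<^sub>R z" for n :: nat
  have "f n \<in> D" for n
  proof -
    have "f n = of_int (int n) *\<^sub>R (l *\<^sub>R y + m *\<^sub>R z) - of_int \<lfloor>real n * l\<rfloor> *\<^sub>R y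
        - of_int \<lfloor>real n * m\<rfloor> *\<^sub>R z"
      by (simp add: f_def frac_def algebra_simps)
    also have "\<dots> \<in> D"
      by (intro diff int_multiple_mem[of D] y z D)
    finally show ?thesis .
  qed
  moreover have "bounded (range f)"
  proof (rule boundedI)
    fix x assume "x \<in> range f"
    then obtain n where "x = f n"
      by blast
    moreover have "norm (frac s *\<^sub>R v) \<le> norm v" for s and v :: 'a
      by (simp add: mult_left_le_one_le less_imp_le[OF frac_lt_1])
    ultimately show "norm x \<le> norm y + norm z"
      unfolding f_def by (simp add: norm_triangle_mono)
  qed
  ultimately have "finite (range f)"
    by (metis disc image_subsetI uniform_discrete_finite_iff uniform_discrete_subset)
  then have "\<not> inj f"
    using finite_imageD infinite_UNIV_nat by blast
  then obtain i j where "i < j" "f i = f j"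
    by (metis injI linorder_neqE_nat)
  then have "(frac (real j * l) - frac (real i * l)) *\<^sub>R y + (frac (real j * m) - frac (real i * m)) *\<^sub>R z = 0"
    by (simp add: f_def algebra_simps)
  then have "frac (real j * l) = frac (real i * l)"
    using indep by fastforce
  then have "real (j - i) * l = of_int (\<lfloor>real j * l\<rfloor> - \<lfloor>real i * l\<rfloor>)"
    using \<open>i < j\<close> by (simp add: frac_def of_nat_diff algebra_simps)
  with \<open>i < j\<close> show ?thesis
    by (metis Ints_of_int zero_less_diff)
qed

lemma floor_quotient_tendsto:
  fixes t :: "nat \<Rightarrow> real"
  assumes "filterlim t at_top sequentially"
  shows "(\<lambda>k. of_int \<lfloor>x * t k\<rfloor> / t k) \<longlonglongrightarrow> x"
proof -
  have pos: "\<forall>\<^sub>F k in sequentially. t k > 0"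
    using assms by (simp add: filterlim_at_top_dense)
  have lower: "(\<lambda>k. x - 1 / t k) \<longlonglongrightarrow> x"
    using tendsto_diff[OF tendsto_const tendsto_divide_0[OF tendsto_const filterlim_at_top_imp_at_infinity[OF assms]]]
    by simp
  have "\<forall>\<^sub>F k in sequentially. x - 1 / t k \<le> of_int \<lfloor>x * t k\<rfloor> / t k"
    using pos
  proof eventually_elim
    case (elim k)
    have "x * t k - 1 \<le> of_int \<lfloor>x * t k\<rfloor>"
      by linarith
    then have "(x * t k - 1) / t k \<le> of_int \<lfloor>x * t k\<rfloor> / t k"
      using elim by (simp add: divide_right_mono)
    with elim show ?case
      by (simp add: diff_divide_distrib)
  qed
  moreover have "\<forall>\<^sub>F k in sequentially. of_int \<lfloor>x * t k\<rfloor> / t k \<le> x"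
    using pos by eventually_elim (simp add: field_simps)
  ultimately show ?thesis
    by (rule tendsto_sandwich[OF _ _ lower tendsto_const])
qed

text \<open>
  The quantity \<open>(\<i> y) \<bullet> z\<close> is the determinant of \<open>y\<close> and \<open>z\<close>, and the coefficients are
  those of Cramer's rule.
\<close>

lemma complex_plane_basis:
  assumes "(\<i> * y) \<bullet> z \<noteq> 0"
  obtains s t where "w = s *\<^sub>R y + t *\<^sub>R z"
proof
  define d where "d = (\<i> * y) \<bullet> z"
  have "d *\<^sub>R w = - ((\<i> * z) \<bullet> w) *\<^sub>R y + ((\<i> * y) \<bullet> w) *\<^sub>R z"
    by (simp add: d_def complex_eq_iff inner_complex_def algebra_simps)
  then have "(1 / d) *\<^sub>R (d *\<^sub>R w) = (- ((\<i> * z) \<bullet> w) / d) *\<^sub>R y + (((\<i> * y) \<bullet> w) / d) *\<^sub>R z"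
    by (simp add: scaleR_add_right scaleR_diff_right)
  then show "w = (- ((\<i> * z) \<bullet> w) / d) *\<^sub>R y + (((\<i> * y) \<bullet> w) / d) *\<^sub>R z"
    using assms by (simp add: d_def)
qed

section \<open>Lattices\<close>

locale path_lattice = path_frame G E
  for G :: "('v::finite, 'e::finite) pre_digraph"
    and E :: "real \<times> complex \<times> complex \<Rightarrow> real ^ ('v + 'e)" +
  fixes \<Gamma> :: "(real ^ ('v + 'e)) set"
  assumes lattice: "lie_lattice (nil_group G) \<Gamma>"
begin

lemma subgroup: "subgroup \<Gamma> (nil_group G)"
  using lattice by (simp add: lie_lattice_def)

lemma mult_mem: "x \<in> \<Gamma> \<Longrightarrow> y \<in> \<Gamma> \<Longrightarrow> x + y + (1 / 2) *\<^sub>R bracket G x y \<in> \<Gamma>"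
  using subgroup.m_closed[OF subgroup] by simp

lemma neg_mem: "x \<in> \<Gamma> \<Longrightarrow> - x \<in> \<Gamma>"
  using subgroup.m_inv_closed[OF subgroup] by simp

lemma multiple_mem:
  assumes "x \<in> \<Gamma>"
  shows "of_int k *\<^sub>R x \<in> \<Gamma>"
proof -
  have nat: "real n *\<^sub>R x \<in> \<Gamma>" for n
  proof (induction n)
    case 0
    then show ?case
      using subgroup.one_closed[OF subgroup] by simp
  next
    case (Suc n)
    then show ?case
      using mult_mem[OF Suc assms] by (simp add: bracket_bilin algebra_simps)
  qed
  show ?thesis
    using nat neg_mem[OF nat] by (cases k rule: int_cases2) auto
qed

lemma commutator_mem:
  assumes "x \<in> \<Gamma>" "y \<in> \<Gamma>"
  shows "bracket G x y \<in> \<Gamma>"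
  using mult_mem[OF mult_mem[OF assms] mult_mem[OF neg_mem neg_mem], OF assms]
  by (simp add: bracket_bilin bracket_skew[of G y x] flip: scaleR_left_distrib)

text \<open>
  A linear functional that vanishes on the centre is a homomorphism from the group to
  the reals. If it vanished on the lattice it would descend to the compact quotient and be
  bounded. Hence the lattice spans the Lie algebra modulo its centre.
\<close>

lemma not_in_hyperplane:
  assumes "a' \<noteq> 0 \<or> b' \<noteq> 0"
  obtains a b c where "E (a, b, c) \<in> \<Gamma>" "a * a' + b \<bullet> b' \<noteq> 0"
proof (rule ccontr)
  assume "\<not> thesis"
  with that have neg: "E (a, b, c) \<in> \<Gamma> \<Longrightarrow> a * a' + b \<bullet> b' = 0" for a b c
    by blast
  define f where "f x = x \<bullet> E (a', b', 0)" for x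
  have f: "f (E (a, b, c)) = a * a' + b \<bullet> b'" for a b c
    by (simp add: f_def inner_E)
  have f0: "f x = 0" if "x \<in> \<Gamma>" for x
    using that by (cases x rule: E_cases) (simp add: f neg)
  let ?\<pi> = "\<lambda>x. \<Gamma> #>\<^bsub>nil_group G\<^esub> x"
  let ?Y = "quotient_topology euclidean ?\<pi>"
  have compact: "compact_space ?Y"
    using lattice by (simp add: lie_lattice_def)
  have mult: "f (x + y + (1 / 2) *\<^sub>R bracket G x y) = f x + f y" for x y
    by (cases x rule: E_cases; cases y rule: E_cases) (simp add: f bracket_E E_arith inner_add_left algebra_simps)
  obtain h where h: "continuous_map ?Y euclideanreal h" "h ` topspace ?Y = f ` topspace euclidean"
  proof (rule quotient_map_lift_exists[OF quotient_map_quotient_topology[of euclidean ?\<pi>]])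
    show "continuous_map euclidean euclideanreal f"
      by (auto simp: f_def[abs_def] intro!: continuous_intros)
    fix x y assume "?\<pi> x = ?\<pi> y"
    moreover have "x \<in> ?\<pi> x"
      using group.rcos_self[OF group_nil_group _ subgroup, of x] by simp
    ultimately obtain g where "g \<in> \<Gamma>" "x = g \<otimes>\<^bsub>nil_group G\<^esub> y"
      by (auto simp: r_coset_def)
    then show "f x = f y"
      using mult f0 by simp
  qed
  have "compactin euclideanreal (h ` topspace ?Y)"
    using compact h(1) image_compactin unfolding compact_space_def by blast
  then have "bounded (range f)"
    unfolding h(2) by (simp add: compact_imp_bounded)
  then obtain B where B: "\<And>x. \<bar>f x\<bar> \<le> B"
    by (auto simp: bounded_iff)
  have "a' * a' + b' \<bullet> b' > 0"
    using assms by (metis add_nonneg_pos add_pos_nonneg inner_ge_zero inner_gt_zero_iff not_real_square_gt_zero zero_le_square)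
  moreover define r where "r = (B + 1) / (a' * a' + b' \<bullet> b')"
  ultimately have "f (E (r * a', r *\<^sub>R b', 0)) = B + 1"
    by (simp add: f field_simps)
  with B[of "E (r * a', r *\<^sub>R b', 0)"] show False
    by simp
qed

lemma uniform_discrete_center: "uniform_discrete {c. E (0, 0, c) \<in> \<Gamma>}"
proof -
  have "0 \<in> \<Gamma>"
    using subgroup.one_closed[OF subgroup] by simp
  moreover have "discrete \<Gamma>"
    using lattice by (simp add: lie_lattice_def)
  ultimately obtain e where e: "e > 0" "\<And>y. y \<in> \<Gamma> \<Longrightarrow> dist 0 y < e \<Longrightarrow> y = 0"
    by (metis discreteD isolated_in_dist_Ex_iff)
  have "c = c'" if "E (0, 0, c) \<in> \<Gamma>" "E (0, 0, c') \<in> \<Gamma>" "dist c c' < e" for c c'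
  proof -
    have "E (0, 0, c - c') \<in> \<Gamma>"
      using mult_mem[OF that(1) neg_mem[OF that(2)]] by (simp add: E_arith bracket_E)
    moreover have "dist 0 (E (0, 0, c - c')) = dist c c'"
      by (simp add: dist_norm norm_eq_sqrt_inner inner_E)
    ultimately have "E (0, 0, c - c') = E 0"
      using e(2) that(3) by (simp add: E_arith)
    then show ?thesis
      unfolding E_eq_iff by (simp add: zero_prod_def)
  qed
  with e(1) show ?thesis
    unfolding uniform_discrete_def by blast
qed

text \<open>
  Powers in this group are multiples, so for \<open>m = n a\<^sub>2 / a\<^sub>1\<close> the product of the \<open>n\<close>-th
  power of the second element with the \<open>(-m)\<close>-th power of the first has first coordinate
  \<open>n a\<^sub>2 - m a\<^sub>1 = 0\<close>.
\<close>

lemma kernel_mem: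
  assumes "E (a1, b1, c1) \<in> \<Gamma>" "E (a2, b2, c2) \<in> \<Gamma>" "real n * (a2 / a1) \<in> \<int>" "a1 \<noteq> 0"
  obtains c where "E (0, (n / a1) *\<^sub>R (a1 *\<^sub>R b2 - a2 *\<^sub>R b1), c) \<in> \<Gamma>"
proof -
  obtain m where m: "n * (a2 / a1) = of_int m"
    using assms(3) by (auto elim: Ints_cases)
  have "of_int (int n) *\<^sub>R E (a2, b2, c2) \<in> \<Gamma>" "of_int (- m) *\<^sub>R E (a1, b1, c1) \<in> \<Gamma>"
    by (rule multiple_mem assms)+
  from mult_mem[OF this] obtain c where "E (n * a2 - m * a1, n *\<^sub>R b2 - m *\<^sub>R b1, c) \<in> \<Gamma>"
    by (simp add: E_arith bracket_E)
  moreover have "n * a2 - m * a1 = 0"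
    using assms(4) by (simp flip: m)
  moreover have "n *\<^sub>R b2 - m *\<^sub>R b1 = (n / a1) *\<^sub>R (a1 *\<^sub>R b2 - a2 *\<^sub>R b1)"
    using assms(4) by (simp add: algebra_simps flip: m)
  ultimately show ?thesis
    using that by metis
qed

text \<open>
  The scale \<open>2 \<pi> (k + 1)\<close> is the angle after which a helix has made \<open>k + 1\<close> rotations. One
  lattice element for each such angle makes the set of approximable vectors a linear subspace,
  because real coefficients can be rounded at every scale.
\<close>

definition approximable :: "complex \<times> complex \<Rightarrow> bool" where
  "approximable v \<longleftrightarrow> (\<exists>\<gamma>. (\<forall>k. E (0, \<gamma> k) \<in> \<Gamma>) \<and> (\<lambda>k. (1 / (2 * pi * real (Suc k))) *\<^sub>R \<gamma> k) \<longlonglongrightarrow> v)"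

lemma approximable_add:
  assumes "approximable v" "approximable w"
  shows "approximable (v + w)"
proof -
  from assms obtain \<gamma> \<delta> where "\<And>k. E (0, \<gamma> k) \<in> \<Gamma>" "\<And>k. E (0, \<delta> k) \<in> \<Gamma>"
    and lim: "(\<lambda>k. (1 / (2 * pi * real (Suc k))) *\<^sub>R \<gamma> k) \<longlonglongrightarrow> v"
      "(\<lambda>k. (1 / (2 * pi * real (Suc k))) *\<^sub>R \<delta> k) \<longlonglongrightarrow> w"
    unfolding approximable_def by blast
  moreover have "E (0, u + u') \<in> \<Gamma>" if "E (0, u) \<in> \<Gamma>" "E (0, u') \<in> \<Gamma>" for u u'
    using mult_mem[OF that] by (cases u; cases u') (simp add: bracket_E E_arith)
  ultimately have "E (0, \<gamma> k + \<delta> k) \<in> \<Gamma>" for k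
    by simp
  moreover have "(\<lambda>k. (1 / (2 * pi * real (Suc k))) *\<^sub>R (\<gamma> k + \<delta> k)) \<longlonglongrightarrow> v + w"
    using tendsto_add[OF lim] by (simp only: scaleR_add_right)
  ultimately show ?thesis
    unfolding approximable_def by (intro exI[of _ "\<lambda>k. \<gamma> k + \<delta> k"]) simp
qed

lemma approximable_scaleR:
  assumes "E (0, v) \<in> \<Gamma>"
  shows "approximable (r *\<^sub>R v)"
proof -
  let ?t = "\<lambda>k. 2 * pi * real (Suc k)"
  have "E (0, of_int \<lfloor>r * ?t k\<rfloor> *\<^sub>R v) \<in> \<Gamma>" for k
    using multiple_mem[OF assms, of "\<lfloor>r * ?t k\<rfloor>"] by (simp only: E_arith scaleR_Pair scaleR_zero_right)
  moreover have "filterlim ?t at_top sequentially"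
    by real_asymp
  then have "(\<lambda>k. (of_int \<lfloor>r * ?t k\<rfloor> / ?t k) *\<^sub>R v) \<longlonglongrightarrow> r *\<^sub>R v"
    by (intro tendsto_scaleR floor_quotient_tendsto tendsto_const)
  then have "(\<lambda>k. (1 / ?t k) *\<^sub>R (of_int \<lfloor>r * ?t k\<rfloor> *\<^sub>R v)) \<longlonglongrightarrow> r *\<^sub>R v"
    by simp
  ultimately show ?thesis
    unfolding approximable_def by (intro exI[of _ "\<lambda>k. of_int \<lfloor>r * ?t k\<rfloor> *\<^sub>R v"]) simp
qed

text \<open>
  The lattice meets the abelian ideal of elements with first coordinate zero in a set that spans it.
  Take \<open>g\<^sub>1, g\<^sub>2, g\<^sub>3\<close> in the lattice that are independent modulo the centre,
  with first coordinates \<open>a\<^sub>i\<close> and \<open>a\<^sub>1 \<noteq> 0\<close>. The commutators \<open>y = [g\<^sub>1, g\<^sub>2]\<close> and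
  \<open>z = [g\<^sub>1, g\<^sub>3]\<close> span the centre, and
  \<open>[g\<^sub>2, g\<^sub>3] = (a\<^sub>2 / a\<^sub>1) z - (a\<^sub>3 / a\<^sub>1) y\<close>. All three lie in a discrete subgroup of the centre,
  so both coefficients are rational, and powers of the \<open>g\<^sub>i\<close> combine to two lattice elements of
  the ideal that are independent modulo the centre.
\<close>

lemma all_approximable: "approximable (b, c)"
proof -
  obtain a1 b1 c1 where 1: "E (a1, b1, c1) \<in> \<Gamma>" "a1 \<noteq> 0"
    using not_in_hyperplane[of 1 0] by auto
  have inner: "a * - (u \<bullet> b1) + b \<bullet> (a1 *\<^sub>R u) = u \<bullet> (a1 *\<^sub>R b - a *\<^sub>R b1)" for a b u
    by (simp add: inner_diff_right inner_commute)
  \<comment> \<open>The hyperplanes are chosen such that \<open>y\<close> has nonzero real part and then \<open>y\<close>, \<open>z\<close> nonzero determinant.\<close>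
  obtain a2 b2 c2 where 2: "E (a2, b2, c2) \<in> \<Gamma>" "1 \<bullet> (a1 *\<^sub>R b2 - a2 *\<^sub>R b1) \<noteq> 0"
    using not_in_hyperplane[of "- (1 \<bullet> b1)" "a1 *\<^sub>R 1"] 1(2) unfolding inner by auto
  define y where "y = a1 *\<^sub>R b2 - a2 *\<^sub>R b1"
  have "y \<noteq> 0"
    using 2(2) unfolding y_def[symmetric] by auto
  obtain a3 b3 c3 where 3: "E (a3, b3, c3) \<in> \<Gamma>" "(\<i> * y) \<bullet> (a1 *\<^sub>R b3 - a3 *\<^sub>R b1) \<noteq> 0"
    using not_in_hyperplane[of "- ((\<i> * y) \<bullet> b1)" "a1 *\<^sub>R (\<i> * y)"] 1(2) \<open>y \<noteq> 0\<close> unfolding inner by auto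
  define z where "z = a1 *\<^sub>R b3 - a3 *\<^sub>R b1"
  have yz: "(\<i> * y) \<bullet> z \<noteq> 0"
    using 3(2) by (simp add: z_def)
  let ?D = "{c. E (0, 0, c) \<in> \<Gamma>}"
  have diff: "u - v \<in> ?D" if "u \<in> ?D" "v \<in> ?D" for u v
    using that mult_mem[OF _ neg_mem, of "E (0, 0, u)" "E (0, 0, v)"] by (simp add: bracket_E E_arith)
  have y: "y \<in> ?D" and z: "z \<in> ?D"
    using commutator_mem[OF 1(1) 2(1)] commutator_mem[OF 1(1) 3(1)] by (simp_all add: bracket_E y_def z_def)
  have indep: "s = 0 \<and> t = 0" if st: "s *\<^sub>R y + t *\<^sub>R z = 0" for s t
  proof -
    have "(\<i> * y) \<bullet> (s *\<^sub>R y + t *\<^sub>R z) = t * ((\<i> * y) \<bullet> z)"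
      by (simp add: inner_complex_def algebra_simps)
    with st yz have "t = 0"
      by simp
    with st \<open>y \<noteq> 0\<close> show ?thesis
      by simp
  qed
  have "(a2 / a1) *\<^sub>R z + (- a3 / a1) *\<^sub>R y = a2 *\<^sub>R b3 - a3 *\<^sub>R b2"
    using 1(2) by (simp add: y_def z_def algebra_simps)
  then have D: "(a2 / a1) *\<^sub>R z + (- a3 / a1) *\<^sub>R y \<in> ?D"
    using commutator_mem[OF 2(1) 3(1)] by (simp add: bracket_E)
  have "\<exists>n>0. real n * (a2 / a1) \<in> \<int>"
    by (rule uniform_discrete_coeff_rational[OF uniform_discrete_center diff z y _ D]) (use indep in \<open>auto simp: add.commute\<close>)
  then obtain n where n: "n > 0" "real n * (a2 / a1) \<in> \<int>"
    by blast
  have "\<exists>n>0. real n * (- a3 / a1) \<in> \<int>"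
    using D by (intro uniform_discrete_coeff_rational[OF uniform_discrete_center diff y z]) (use indep in \<open>auto simp: add.commute\<close>)
  then obtain n' where n': "n' > 0" "real n' * (a3 / a1) \<in> \<int>"
    by auto
  obtain d where d: "E (0, (n / a1) *\<^sub>R y, d) \<in> \<Gamma>"
    using kernel_mem[OF 1(1) 2(1) n(2) 1(2)] unfolding y_def .
  obtain d' where d': "E (0, (n' / a1) *\<^sub>R z, d') \<in> \<Gamma>"
    using kernel_mem[OF 1(1) 3(1) n'(2) 1(2)] unfolding z_def .
  obtain s t where st: "b = s *\<^sub>R y + t *\<^sub>R z"
    using complex_plane_basis[OF yz] .
  define r where "r = s * a1 / n"
  define r' where "r' = t * a1 / n'"
  obtain s' t' where st': "c - r *\<^sub>R d - r' *\<^sub>R d' = s' *\<^sub>R y + t' *\<^sub>R z"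
    using complex_plane_basis[OF yz] .
  have "(b, c) = r *\<^sub>R ((n / a1) *\<^sub>R y, d) + r' *\<^sub>R ((n' / a1) *\<^sub>R z, d') + s' *\<^sub>R (0, y) + t' *\<^sub>R (0, z)"
    using st st' 1(2) n(1) n'(1) by (simp add: r_def r'_def algebra_simps)
  also have "approximable \<dots>"
    using d d' y z by (intro approximable_add approximable_scaleR) simp_all
  finally show ?thesis .
qed

section \<open>Density of the closed geodesics\<close>

text \<open>
  The unit vectors of the group itself that project to closed geodesics. Working with them leaves the
  quotient topology to the very last step.
\<close>

definition closed_geodesic_velocities :: "((real ^ ('v + 'e)) \<times> (real ^ ('v + 'e))) set" where
  "closed_geodesic_velocities = {w \<in> unit_tangent_bundle (nil_group G).
     tangent_orbit (nil_group G) \<Gamma> w \<in> closed_geodesic_unit_vectors (nil_group G) \<Gamma>}"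

lemma unit_helix_velocity_closed:
  assumes z: "cmod z = 1" and k: "k > 0"
    and mem: "E (0, (2 * pi * real k) *\<^sub>R (Complex 0 S * z, Complex (1 + \<rho>\<^sup>2 / 2) (\<alpha> * S) * z)) \<in> \<Gamma>"
  shows "unit_helix_velocity (E (\<alpha>, \<beta>, \<zeta>)) \<rho> S z \<tau> \<in> closed_geodesic_velocities"
proof -
  let ?N = "nil_group G"
  define p where "p = E (\<alpha>, \<beta>, \<zeta>)"
  define r where "r = 1 / sqrt (1 + S\<^sup>2 + \<rho>\<^sup>2)"
  have r: "r > 0"
    by (simp add: r_def add_pos_nonneg)
  define c where "c t = p \<otimes>\<^bsub>?N\<^esub> E (helix \<rho> S z (r * t))" for t
  define \<sigma> where "\<sigma> t = \<Gamma> #>\<^bsub>?N\<^esub> c t" for t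
  define \<omega> where "\<omega> = 2 * pi * real k / r"
  define g where "g = E (0, (2 * pi * real k) *\<^sub>R (Complex 0 S * z, Complex (1 + \<rho>\<^sup>2 / 2) (\<alpha> * S) * z))"
  have lift: "geodesic_lift_at ?N \<Gamma> \<sigma> t c" for t
    unfolding geodesic_lift_at_def \<sigma>_def c_def
    using geodesic_translated_helix(1)[OF z] by (simp add: always_eventually del: nil_group_simps(2))
  have "\<sigma> (t + \<omega>) = \<sigma> t" for t
  proof -
    have "c (t + \<omega>) = g \<otimes>\<^bsub>?N\<^esub> c t"
      using r helix_translation[of \<alpha> \<beta> \<zeta> \<rho> S z "r * t" k]
      by (simp add: c_def p_def g_def \<omega>_def distrib_left del: nil_group_simps(2))
    then have "\<sigma> (t + \<omega>) = (\<Gamma> #>\<^bsub>?N\<^esub> g) #>\<^bsub>?N\<^esub> c t"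
      unfolding \<sigma>_def by (simp add: group.coset_mult_assoc[OF group_nil_group] del: nil_group_simps(2))
    also have "\<Gamma> #>\<^bsub>?N\<^esub> g = \<Gamma>"
      using subgroup.rcos_const[OF subgroup group_nil_group] mem by (simp add: g_def)
    finally show ?thesis
      by (simp add: \<sigma>_def)
  qed
  moreover have "\<omega> > 0"
    using k r by (simp add: \<omega>_def)
  ultimately have closed: "closed_geodesic ?N \<Gamma> \<sigma>"
    using lift unfolding closed_geodesic_def quot_geodesic_def by blast
  have vel: "(c (\<tau> / r), velocity c (\<tau> / r)) = unit_helix_velocity p \<rho> S z \<tau>"
    using r geodesic_translated_helix(2)[OF z, of p \<rho> S r "\<tau> / r"]
    unfolding unit_helix_velocity_def c_def[abs_def] r_def[symmetric]
    by (simp add: Let_def del: nil_group_simps(2))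
  have "norm (r *\<^sub>R E (hodograph \<rho> S z \<tau>)) = 1"
    using r by (simp add: norm_hodograph[OF z] r_def)
  then have unit: "unit_helix_velocity p \<rho> S z \<tau> \<in> unit_tangent_bundle ?N"
    unfolding unit_helix_velocity_def Let_def mem_unit_tangent_bundle_iff r_def[symmetric]
    by (simp add: bracket_bilin)
  then have "tangent_orbit ?N \<Gamma> (unit_helix_velocity p \<rho> S z \<tau>) \<in> closed_geodesic_unit_vectors ?N \<Gamma>"
    using closed lift unfolding closed_geodesic_unit_vectors_def vel[symmetric] by blast
  with unit show ?thesis
    by (simp add: closed_geodesic_velocities_def p_def)
qed

text \<open>
  A translated helix projects to a closed geodesic when \<open>2 \<pi> k\<close> times the pair
  \<open>\<eta> = \<i> S z\<close>, \<open>\<theta> = (1 + \<rho>\<^sup>2 / 2 + \<i> \<alpha> S) z\<close> gives a lattice element. Conversely, once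
  the sign of \<open>S\<close> is fixed, the parameters are continuous functions of \<open>(\<eta>, \<theta>)\<close>:
  \<open>|S| = |\<eta>|\<close>, \<open>z = \<eta> / (\<i> S)\<close>, and \<open>\<theta> / \<eta> = \<alpha> - \<i> (1 + \<rho>\<^sup>2 / 2) / S\<close> determines
  \<open>\<alpha>\<close> and \<open>\<rho>\<^sup>2\<close>. So approximating \<open>(\<eta>, \<theta>)\<close> by rescaled lattice elements
  approximates the given vector by vectors tangent to closed geodesics, with the same \<open>\<beta>\<close>,
  \<open>\<zeta>\<close> and \<open>\<tau>\<close>.
\<close>

lemma unit_helix_velocity_closure:
  assumes \<rho>: "\<rho> > 0" and S: "S \<noteq> 0" and z: "cmod z = 1"
  shows "unit_helix_velocity p \<rho> S z \<tau> \<in> closure closed_geodesic_velocities"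
proof -
  obtain \<alpha> \<beta> \<zeta> where p: "p = E (\<alpha>, \<beta>, \<zeta>)"
    by (cases p rule: E_cases)
  obtain \<gamma> where \<gamma>: "\<And>k. E (0, \<gamma> k) \<in> \<Gamma>"
    and lim: "(\<lambda>k. (1 / (2 * pi * real (Suc k))) *\<^sub>R \<gamma> k)
      \<longlonglongrightarrow> (Complex 0 S * z, Complex (1 + \<rho>\<^sup>2 / 2) (\<alpha> * S) * z)"
    using all_approximable unfolding approximable_def by blast
  define \<eta> where "\<eta> k = fst ((1 / (2 * pi * real (Suc k))) *\<^sub>R \<gamma> k)" for k
  define \<theta> where "\<theta> k = snd ((1 / (2 * pi * real (Suc k))) *\<^sub>R \<gamma> k)" for k
  have \<gamma>_eq: "\<gamma> k = (2 * pi * real (Suc k)) *\<^sub>R (\<eta> k, \<theta> k)" for k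
    by (simp add: \<eta>_def \<theta>_def del: of_nat_Suc)
  have \<eta>: "\<eta> \<longlonglongrightarrow> Complex 0 S * z" and \<theta>: "\<theta> \<longlonglongrightarrow> Complex (1 + \<rho>\<^sup>2 / 2) (\<alpha> * S) * z"
    using tendsto_fst[OF lim] tendsto_snd[OF lim] by (simp_all add: \<eta>_def[abs_def] \<theta>_def[abs_def])
  \<comment> \<open>The sign of \<open>S\<close> is kept, and \<open>B k\<close> plays the role of the square of \<open>\<rho>\<close>.\<close>
  define q where "q k = \<theta> k / \<eta> k" for k
  define S' where "S' k = sgn S * cmod (\<eta> k)" for k
  define z' where "z' k = \<eta> k / Complex 0 (S' k)" for k
  define B where "B k = - 2 * S' k * Im (q k) - 2" for k
  have nz: "Complex 0 S \<noteq> 0" "z \<noteq> 0"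
    using S z by (simp add: complex_eq_iff) (use z in auto)
  have "(Complex (1 + \<rho>\<^sup>2 / 2) (\<alpha> * S) * z) / (Complex 0 S * z) = Complex \<alpha> (- (1 + \<rho>\<^sup>2 / 2) / S)"
  proof -
    have eq: "Complex (1 + \<rho>\<^sup>2 / 2) (\<alpha> * S) = Complex \<alpha> (- (1 + \<rho>\<^sup>2 / 2) / S) * Complex 0 S"
      using S by (simp add: complex_eq_iff)
    show ?thesis
      unfolding eq mult.assoc by (intro nonzero_mult_div_cancel_right no_zero_divisors nz)
  qed
  moreover have "q \<longlonglongrightarrow> (Complex (1 + \<rho>\<^sup>2 / 2) (\<alpha> * S) * z) / (Complex 0 S * z)"
    unfolding q_def using nz by (intro tendsto_divide \<theta> \<eta>) simp
  ultimately have q: "q \<longlonglongrightarrow> Complex \<alpha> (- (1 + \<rho>\<^sup>2 / 2) / S)"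
    by simp
  have "sgn S * cmod (Complex 0 S * z) = S"
    using z by (simp add: norm_mult complex_norm abs_mult_sgn mult.commute)
  moreover have "S' \<longlonglongrightarrow> sgn S * cmod (Complex 0 S * z)"
    unfolding S'_def by (intro tendsto_intros \<eta>)
  ultimately have S': "S' \<longlonglongrightarrow> S"
    by (simp only:)
  then have "(\<lambda>k. \<eta> k / Complex 0 (S' k)) \<longlonglongrightarrow> (Complex 0 S * z) / Complex 0 S"
    by (intro tendsto_divide \<eta> tendsto_Complex tendsto_const nz(1))
  then have z': "z' \<longlonglongrightarrow> z"
    using nz by (simp add: z'_def[abs_def])
  have "B \<longlonglongrightarrow> - 2 * S * Im (Complex \<alpha> (- (1 + \<rho>\<^sup>2 / 2) / S)) - 2"
    unfolding B_def by (intro tendsto_intros S' q)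
  then have B: "B \<longlonglongrightarrow> \<rho>\<^sup>2"
    using S by simp
  have \<alpha>: "(\<lambda>k. Re (q k)) \<longlonglongrightarrow> \<alpha>"
    using tendsto_Re[OF q] by simp
  have \<rho>': "(\<lambda>k. sqrt (B k)) \<longlonglongrightarrow> \<rho>"
    using tendsto_real_sqrt[OF B] \<rho> by simp
  have "\<forall>\<^sub>F k in sequentially. \<eta> k \<noteq> 0"
    using nz by (intro tendsto_imp_eventually_ne[OF \<eta>]) simp
  moreover have "\<forall>\<^sub>F k in sequentially. B k > 0"
    using \<rho> by (intro order_tendstoD[OF B]) simp
  ultimately have ev: "\<forall>\<^sub>F k in sequentially.
      unit_helix_velocity (E (Re (q k), \<beta>, \<zeta>)) (sqrt (B k)) (S' k) (z' k) \<tau> \<in> closed_geodesic_velocities"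
  proof eventually_elim
    case (elim k)
    have S'0: "S' k \<noteq> 0"
      using elim S by (simp add: S'_def sgn_eq_0_iff)
    have z1: "cmod (z' k) = 1"
      using elim S by (simp add: z'_def S'_def norm_divide complex_norm abs_mult abs_sgn_eq)
    have \<eta>_eq: "\<eta> k = Complex 0 (S' k) * z' k"
      using S'0 by (simp add: z'_def complex_eq_iff)
    have "\<theta> k = q k * \<eta> k"
      using elim by (simp add: q_def)
    also have "\<dots> = Complex (1 + (sqrt (B k))\<^sup>2 / 2) (Re (q k) * S' k) * z' k"
    proof -
      have "1 + (sqrt (B k))\<^sup>2 / 2 = - S' k * Im (q k)"
        using elim by (simp add: B_def field_simps)
      then show ?thesis
        by (simp add: \<eta>_eq complex_eq_iff algebra_simps)
    qed
    finally have "E (0, (2 * pi * real (Suc k)) *\<^sub>R (Complex 0 (S' k) * z' k,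
        Complex (1 + (sqrt (B k))\<^sup>2 / 2) (Re (q k) * S' k) * z' k)) \<in> \<Gamma>"
      using \<gamma>[of k] unfolding \<gamma>_eq by (simp only: \<eta>_eq)
    then show ?case
      by (rule unit_helix_velocity_closed[OF z1 zero_less_Suc])
  qed
  have "\<forall>\<^sub>F k in sequentially.
      unit_helix_velocity (E (Re (q k), \<beta>, \<zeta>)) (sqrt (B k)) (S' k) (z' k) \<tau> \<in> closure closed_geodesic_velocities"
    using ev by eventually_elim (rule subsetD[OF closure_subset])
  then show ?thesis
    unfolding p
    by (rule Lim_in_closed_set[OF closed_closure _ _ unit_helix_velocity_tendsto[OF \<alpha> \<rho>' S' z']]) simp
qed

text \<open>
  It remains to approximate the unit vectors \<open>Q = (a, b, c)\<close> with \<open>a * Im (b * cnj c) = 0\<close>. Along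
  the line \<open>Q + s (1, \<i>, 1)\<close> this expression is a monic cubic polynomial in \<open>s\<close>, so it has no
  zeros \<open>s \<noteq> 0\<close> near \<open>0\<close>; being homogeneous, it stays nonzero after normalizing.
\<close>

lemma unit_tangent_bundle_subset_closure: "unit_tangent_bundle (nil_group G) \<subseteq> closure closed_geodesic_velocities"
proof clarify
  fix x v assume "(x, v) \<in> unit_tangent_bundle (nil_group G)"
  define Q where "Q = v - (1 / 2) *\<^sub>R bracket G x v"
  have Q: "norm Q = 1"
    using \<open>(x, v) \<in> _\<close> by (simp add: mem_unit_tangent_bundle_iff Q_def)
  have v: "v = Q + (1 / 2) *\<^sub>R bracket G x Q"
    by (simp add: Q_def bracket_bilin)
  interpret b: bounded_bilinear "bracket G"
    using bilinear_bracket bilinear_conv_bounded_bilinear by blast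
  obtain a b c where abc: "Q = E (a, b, c)"
    by (cases Q rule: E_cases)
  define f where "f s = Q + s *\<^sub>R E (1, \<i>, 1)" for s :: real
  define u where "u s = (1 / norm (f s)) *\<^sub>R f s" for s
  let ?V = "\<lambda>s. (x, u s + (1 / 2) *\<^sub>R bracket G x (u s))"
  have "(f \<longlongrightarrow> Q + 0 *\<^sub>R E (1, \<i>, 1)) (at 0)"
    unfolding f_def by (intro tendsto_intros)
  then have f: "(f \<longlongrightarrow> Q) (at 0)"
    by simp
  then have "((\<lambda>s. (1 / norm (f s)) *\<^sub>R f s) \<longlongrightarrow> (1 / norm Q) *\<^sub>R Q) (at 0)"
    using Q by (intro tendsto_intros) auto
  then have "(u \<longlongrightarrow> Q) (at 0)"
    using Q by (simp add: u_def[abs_def])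
  then have lim: "(?V \<longlongrightarrow> (x, v)) (at 0)"
    unfolding v by (intro tendsto_intros b.tendsto)
  let ?P = "[:a, 1:] * [:Im (b * cnj c), Re c + Im b, 1:]"
  have P: "poly ?P s = (a + s) * Im ((b + s *\<^sub>R \<i>) * cnj (c + s *\<^sub>R 1))" for s
    by (simp add: algebra_simps)
  have "finite {s. poly ?P s = 0}"
    by (intro poly_roots_finite) (simp only: mult_eq_0_iff, simp)
  then have "\<forall>\<^sub>F s in at 0. s \<notin> {s. poly ?P s = 0}"
    using islimpt_finite islimpt_iff_eventually by blast
  then have "\<forall>\<^sub>F s in at 0. ?V s \<in> closure closed_geodesic_velocities"
  proof eventually_elim
    case (elim s)
    let ?a = "a + s" and ?b = "b + s *\<^sub>R \<i>" and ?c = "c + s *\<^sub>R 1"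
    have fs: "f s = E (?a, ?b, ?c)"
      by (simp add: f_def abc E_arith)
    have "?a \<noteq> 0" and im: "Im (?b * cnj ?c) \<noteq> 0"
      using elim unfolding P by auto
    then have "f s \<noteq> 0"
      using E_eq_iff[of "(?a, ?b, ?c)" 0] unfolding fs E_arith(5) by (simp add: zero_prod_def)
    define n where "n = 1 / norm (f s)"
    have n: "n > 0"
      using \<open>f s \<noteq> 0\<close> by (simp add: n_def)
    have us: "u s = E (n *\<^sub>R ?a, n *\<^sub>R ?b, n *\<^sub>R ?c)"
      by (simp only: u_def n_def fs E_arith scaleR_Pair)
    have "norm (u s) = 1"
      using \<open>f s \<noteq> 0\<close> by (simp add: u_def)
    moreover have "n *\<^sub>R ?a \<noteq> 0"
      using n \<open>?a \<noteq> 0\<close> by simp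
    moreover have "Im ((n *\<^sub>R ?b) * cnj (n *\<^sub>R ?c)) = n * n * Im (?b * cnj ?c)"
      by (simp add: algebra_simps)
    then have "Im ((n *\<^sub>R ?b) * cnj (n *\<^sub>R ?c)) \<noteq> 0"
      using n im by simp
    ultimately show ?case
      using generic_unit_helix_velocity unit_helix_velocity_closure unfolding us by metis
  qed
  then show "(x, v) \<in> closure closed_geodesic_velocities"
    by (rule Lim_in_closed_set[OF closed_closure _ _ lim]) simp
qed

text \<open>
  Density passes to the quotient because the continuous projection maps closures into closures.
\<close>

lemma density_of_closed_geodesics: "density_of_closed_geodesics (nil_group G) \<Gamma>"
  unfolding density_of_closed_geodesics_def
proof (rule antisym[OF closure_of_subset_topspace])
  let ?UT = "top_of_set (unit_tangent_bundle (nil_group G))"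
  let ?o = "tangent_orbit (nil_group G) \<Gamma>"
  let ?Y = "quot_unit_tangent_bundle (nil_group G) \<Gamma>"
  have "closed_geodesic_velocities \<subseteq> unit_tangent_bundle (nil_group G)"
    by (auto simp: closed_geodesic_velocities_def)
  then have "?UT closure_of closed_geodesic_velocities = unit_tangent_bundle (nil_group G)"
    using unit_tangent_bundle_subset_closure by (simp add: closure_of_subtopology Int_absorb1 Int_absorb2)
  then have "topspace ?Y = ?o ` (?UT closure_of closed_geodesic_velocities)"
    by (simp add: quot_unit_tangent_bundle_def)
  also have "\<dots> \<subseteq> ?Y closure_of (?o ` closed_geodesic_velocities)"
    unfolding quot_unit_tangent_bundle_def
    by (intro continuous_map_image_closure_subset quotient_imp_continuous_map quotient_map_quotient_topology)
  also have "\<dots> \<subseteq> ?Y closure_of closed_geodesic_unit_vectors (nil_group G) \<Gamma>"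
    by (intro closure_of_mono) (auto simp: closed_geodesic_velocities_def)
  finally show "topspace ?Y \<subseteq> ?Y closure_of closed_geodesic_unit_vectors (nil_group G) \<Gamma>" .
qed

end

theorem corollary5p15:
  fixes G :: "('v::finite, 'e::finite) pre_digraph"
    and \<Gamma> :: "(real ^ ('v + 'e)) set"
  assumes "verts G = UNIV" and "arcs G = UNIV" and "path3 G"
    and "lie_lattice (nil_group G) \<Gamma>"
  shows "density_of_closed_geodesics (nil_group G) \<Gamma>"
proof -
  obtain E where "path_frame G E"
    using path3_frame assms(1-3) by blast
  then interpret path_lattice G E \<Gamma>
    using assms(4) by (simp add: path_lattice_def path_lattice_axioms_def)
  show ?thesis
    by (rule density_of_closed_geodesics)
qed

end
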